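(* Let $g$, $v$, $w_\eta$ satisfy the hypotheses listed in the context, let $\rho_0\in\mathrm{BV}(\mathbb{R};[0,\rho_{\max}])$, and let $\rho_j^n$, $j\in\mathbb{Z}$, $n\in\mathbb{N}$, be given by the Godunov type scheme described in the context. Let the CFL condition $$\lambda\le\frac{1}{\gamma_0\|v'\|\|g\|+\|v\|\|g'\|}$$ hold. Then $$|\rho_j^{n+1}-\kappa|-|\rho_j^n-\kappa|+\lambda\big(F_{j+\frac12}^\kappa(\rho_j^n)-F_{j-\frac12}^\kappa(\rho_{j-1}^n)\big)+\lambda\,\mathrm{sgn}(\rho_j^{n+1}-\kappa)\,g(\kappa)\,\big(V_{j+\frac12}^n-V_{j-\frac12}^n\big)\le 0$$ for all $j\in\mathbb{Z}$, $n\in\mathbb{N}$ and $\kappa\in I=[0,\rho_{\max}]$, where $$F_{j+\frac12}^\kappa(u)=V_{j+\frac12}^n\, g(\max(u,\kappa))-V_{j+\frac12}^n\, g(\min(u,\kappa)).$$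
   Context: Hypotheses on the data. $\mathbb{R}^+=[0,\infty)$, $\rho_{\max}>0$, $I=[0,\rho_{\max}]$; $g\in C^1(I;\mathbb{R}^+)$ with $g'\ge 0$; $v\in C^2(I;\mathbb{R}^+)$ with $v'\le 0$; for every $\eta>0$, $w_\eta\in C^1([0,\eta];\mathbb{R}^+)$ with $w_\eta'\le 0$ and $\int_0^\eta w_\eta(x)\,dx=W_0$, where the constant $W_0$ does not depend on $\eta$, and $\lim_{\eta\to\infty}w_\eta(0)=0$. $\mathrm{BV}(\mathbb{R};J)$ denotes the integrable functions on $\mathbb{R}$ of bounded total variation with values in $J$. $\|\cdot\|$ is the $L^\infty$ norm on $I$ for $g,g',v,v'$. $\mathrm{sgn}(0)=0$. Godunov type scheme. $\eta>0$ is fixed; $h>0$ is a space step with $\eta=Nh$ for some integer $N\ge1$; $\tau>0$ is the time step, $\lambda=\tau/h$, $x_{j+\frac12}=(j+\frac12)h$ for $j\in\mathbb{Z}$. Set $\gamma_k=\int_{kh}^{(k+1)h}w_\eta(y)\,dy$ for $k=0,\dots,N-1$, and $$\rho_j^0=\frac1h\int_{x_{j-1/2}}^{x_{j+1/2}}\rho_0(x)\,dx,\qquad V_{j+\frac12}^n=\sum_{k=0}^{N-1}\gamma_k v(\rho_{j+k+1}^n),\qquad \rho_j^{n+1}=\rho_j^n-\lambda\big(V_{j+\frac12}^n g(\rho_j^n)-V_{j-\frac12}^n g(\rho_{j-1}^n)\big).$$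
   Formalization: The formal theorem adds the assumption W_0 ≤ 1; for each W_0 > 1 the claim fails, e.g. for g(r)=r, v=1, w_η=W_0/η, λ=1, ρ_0 the indicator of cell 0, κ=0. *)

theory Defs
  imports "HOL-Probability.Essential_Supremum"
begin

text \<open>
  Derivatives are relative to \<open>S\<close>, hence one-sided at the end points of a closed interval: the data
  \<open>g\<close>, \<open>v\<close>, \<open>w\<close> are functions on closed intervals, and their values elsewhere are irrelevant.
\<close>

definition deriv_on :: "real set \<Rightarrow> (real \<Rightarrow> real) \<Rightarrow> real \<Rightarrow> real" where
  "deriv_on S f x = vector_derivative f (at x within S)"

primrec Ck_on :: "nat \<Rightarrow> real set \<Rightarrow> (real \<Rightarrow> real) \<Rightarrow> bool" where
  "Ck_on 0 S f \<longleftrightarrow> continuous_on S f"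
| "Ck_on (Suc k) S f \<longleftrightarrow> f differentiable_on S \<and> Ck_on k S (deriv_on S f)"

definition Linf_norm :: "real set \<Rightarrow> (real \<Rightarrow> real) \<Rightarrow> real" where
  "Linf_norm S f = real_of_ereal (esssup (lebesgue_on S) (\<lambda>x. ereal \<bar>f x\<bar>))"

definition bounded_total_variation :: "(real \<Rightarrow> real) \<Rightarrow> bool" where
  "bounded_total_variation f \<longleftrightarrow>
     (\<exists>B. \<forall>n (x :: nat \<Rightarrow> real). strict_mono x \<longrightarrow> (\<Sum>i<n. \<bar>f (x (Suc i)) - f (x i)\<bar>) \<le> B)"

definition BV :: "real set \<Rightarrow> (real \<Rightarrow> real) set" where
  "BV J = {f. f absolutely_integrable_on UNIV \<and> bounded_total_variation f \<and> range f \<subseteq> J}"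

definition kernel_weight :: "(real \<Rightarrow> real) \<Rightarrow> real \<Rightarrow> nat \<Rightarrow> real" where
  "kernel_weight w h k = integral {real k * h..real (k + 1) * h} w"

definition cell_average :: "(real \<Rightarrow> real) \<Rightarrow> real \<Rightarrow> int \<Rightarrow> real" where
  "cell_average \<rho>\<^sub>0 h j =
     1 / h * integral {(real_of_int j - 1 / 2) * h..(real_of_int j + 1 / 2) * h} \<rho>\<^sub>0"

text \<open>
  Quantities at the cell interface \<open>x\<^bsub>j+1/2\<^esub>\<close> are indexed by \<open>j\<close>, so that the one at
  \<open>x\<^bsub>j-1/2\<^esub>\<close> has index \<open>j - 1\<close>.
\<close>

definition nonlocal_velocity ::
    "nat \<Rightarrow> (nat \<Rightarrow> real) \<Rightarrow> (real \<Rightarrow> real) \<Rightarrow> (int \<Rightarrow> real) \<Rightarrow> int \<Rightarrow> real" where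
  "nonlocal_velocity N \<gamma> v r j = (\<Sum>k<N. \<gamma> k * v (r (j + int k + 1)))"

primrec godunov ::
    "nat \<Rightarrow> (nat \<Rightarrow> real) \<Rightarrow> (real \<Rightarrow> real) \<Rightarrow> (real \<Rightarrow> real) \<Rightarrow> real \<Rightarrow> (int \<Rightarrow> real)
      \<Rightarrow> nat \<Rightarrow> int \<Rightarrow> real" where
  "godunov N \<gamma> g v lam r\<^sub>0 0 = r\<^sub>0"
| "godunov N \<gamma> g v lam r\<^sub>0 (Suc n) = (\<lambda>j. let r = godunov N \<gamma> g v lam r\<^sub>0 n; V = nonlocal_velocity N \<gamma> v r
     in r j - lam * (V j * g (r j) - V (j - 1) * g (r (j - 1))))"

definition entropy_flux :: "(real \<Rightarrow> real) \<Rightarrow> real \<Rightarrow> real \<Rightarrow> real \<Rightarrow> real" where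
  "entropy_flux g V \<kappa> u = V * g (max u \<kappa>) - V * g (min u \<kappa>)"

end

theory Submission
  imports Defs
begin

text \<open>
  Since the kernel weights decrease, summation by parts gives
  \<open>\<gamma>\<^sub>0 (v (\<rho>\<^sub>j) - max v) \<le> V\<^bsub>j-1/2\<^esub> - V\<^bsub>j+1/2\<^esub> \<le> \<gamma>\<^sub>0 (v (\<rho>\<^sub>j) - min v)\<close>. Together with the CFL
  condition and \<open>W0 \<le> 1\<close> (so that \<open>V \<le> \<parallel>v\<parallel>\<close>) this keeps all cell values in \<open>I\<close>. There \<open>g\<close> is
  nondecreasing, so for fixed velocities the step is monotone in \<open>\<rho>\<^sub>j\<close> and \<open>\<rho>\<^bsub>j-1\<^esub>\<close>, and
  comparison with the constant state \<open>\<kappa>\<close> yields the entropy inequality.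
\<close>

section \<open>Calculus on closed intervals and the essential supremum norm\<close>

lemma Ck_onD:
  assumes "Ck_on (Suc k) S f"
  shows "f differentiable_on S" "continuous_on S f" "Ck_on k S (deriv_on S f)"
  using assms differentiable_imp_continuous_on by auto

lemma Ck_on_imp_continuous_on: "Ck_on k S f \<Longrightarrow> continuous_on S f"
  by (cases k) (auto simp: differentiable_imp_continuous_on)

text \<open>The derivative relative to \<open>{a..b}\<close> restricts to the smaller interval
  \<open>{x..y}\<close>, where the mean value theorem applies. The product form also covers
  \<open>x = y\<close>.\<close>

lemma deriv_on_mvt:
  fixes f :: "real \<Rightarrow> real"
  assumes f: "f differentiable_on {a..b}" and "a \<le> x" "x \<le> y" "y \<le> b"
  obtains z where "z \<in> {a..b}" "f y - f x = deriv_on {a..b} f z * (y - x)"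
proof -
  have "(f has_derivative (*) (deriv_on {a..b} f z)) (at z within {x..y})"
    if "x \<le> z" "z \<le> y" for z
  proof -
    have "f differentiable (at z within {a..b})"
      using f assms(2-) that by (auto simp: differentiable_on_def)
    then have "(f has_real_derivative deriv_on {a..b} f z) (at z within {a..b})"
      by (simp add: vector_derivative_works deriv_on_def
          has_real_derivative_iff_has_vector_derivative)
    then show ?thesis
      unfolding has_field_derivative_def
      by (rule has_derivative_subset) (use assms(2-) in auto)
  qed
  from mvt_very_simple[OF \<open>x \<le> y\<close> this]
  obtain z where "z \<in> {x..y}" "f y - f x = deriv_on {a..b} f z * (y - x)"
    by blast
  then show thesis
    using that[of z] assms(2-) by auto
qed

lemma mono_on_if_deriv_on_nonneg:
  fixes f :: "real \<Rightarrow> real"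
  assumes "f differentiable_on {a..b}" and "\<forall>x\<in>{a..b}. 0 \<le> deriv_on {a..b} f x"
  shows "mono_on {a..b} f"
proof (rule mono_onI)
  fix x y assume "x \<in> {a..b}" "y \<in> {a..b}" "x \<le> y"
  then obtain z where "z \<in> {a..b}" "f y - f x = deriv_on {a..b} f z * (y - x)"
    using deriv_on_mvt[OF assms(1), of x y] by auto
  moreover have "0 \<le> deriv_on {a..b} f z * (y - x)"
    using assms(2) \<open>z \<in> _\<close> \<open>x \<le> y\<close> by simp
  ultimately show "f x \<le> f y" by simp
qed

lemma antimono_on_if_deriv_on_nonpos:
  fixes f :: "real \<Rightarrow> real"
  assumes "f differentiable_on {a..b}" and "\<forall>x\<in>{a..b}. deriv_on {a..b} f x \<le> 0"
  shows "antimono_on {a..b} f"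
proof (rule monotone_onI)
  fix x y assume "x \<in> {a..b}" "y \<in> {a..b}" "x \<le> y"
  then obtain z where "z \<in> {a..b}" "f y - f x = deriv_on {a..b} f z * (y - x)"
    using deriv_on_mvt[OF assms(1), of x y] by auto
  moreover have "deriv_on {a..b} f z * (y - x) \<le> 0"
    using assms(2) \<open>z \<in> _\<close> \<open>x \<le> y\<close> by (simp add: mult_nonpos_nonneg)
  ultimately show "f y \<le> f x" by simp
qed

text \<open>The bound \<open>d\<close> rules out infinity, which \<open>real_of_ereal\<close> would
  send to 0.\<close>

lemma le_real_of_ereal:
  assumes "ereal c \<le> e" "e \<le> ereal d"
  shows "c \<le> real_of_ereal e"
  using assms by (cases e) auto

text \<open>The essential supremum bounds |f| only almost everywhere. By continuity the set
  \<open>C\<close> where the bound holds is closed, so it contains the open interval and then, as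
  \<open>a < b\<close>, also the end points.\<close>

lemma Linf_norm_ge:
  fixes f :: "real \<Rightarrow> real"
  assumes "a < b" and f: "continuous_on {a..b} f" and x: "x \<in> {a..b}"
  shows "\<bar>f x\<bar> \<le> Linf_norm {a..b} f"
proof -
  let ?M = "lebesgue_on {a..b}" and ?E = "esssup (lebesgue_on {a..b}) (\<lambda>x. ereal \<bar>f x\<bar>)"
  define C where "C = {x \<in> {a..b}. ereal \<bar>f x\<bar> \<le> ?E}"
  have cont: "continuous_on {a..b} (\<lambda>x. ereal \<bar>f x\<bar>)"
    using f by (intro continuous_intros continuous_on_ereal) auto
  have "(\<lambda>x. \<bar>f x\<bar>) \<in> borel_measurable ?M"
    using f by (intro continuous_imp_measurable_on_sets_lebesgue continuous_intros) auto
  then have meas: "(\<lambda>x. ereal \<bar>f x\<bar>) \<in> borel_measurable ?M"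
    by simp
  \<comment> \<open>Compactness makes \<open>?E\<close> finite, so its conversion to a real number
    loses nothing.\<close>
  have "compact ((\<lambda>x. \<bar>f x\<bar>) ` {a..b})"
    using f by (intro compact_continuous_image continuous_intros) auto
  then have "bounded ((\<lambda>x. \<bar>f x\<bar>) ` {a..b})"
    by (rule compact_imp_bounded)
  then obtain B where B: "\<forall>x\<in>{a..b}. \<bar>f x\<bar> \<le> B"
    unfolding bounded_iff by auto
  have "?E \<le> ereal B"
    by (rule esssup_I[OF meas AE_I2]) (use B in simp)
  have "C = {a..b} \<inter> (\<lambda>x. ereal \<bar>f x\<bar>) -` {..?E}"
    by (auto simp: C_def)
  then have "closed C"
    using continuous_closed_preimage[OF cont] by simp
  have "AE x \<in> {a<..<b} in lebesgue. x \<in> C"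
  proof -
    have "AE x in ?M. ereal \<bar>f x\<bar> \<le> ?E"
      by (rule esssup_AE)
    then have "AE x in lebesgue. x \<in> {a..b} \<longrightarrow> ereal \<bar>f x\<bar> \<le> ?E"
      by (simp add: AE_restrict_space_iff)
    then show ?thesis
      by eventually_elim (auto simp: C_def)
  qed
  then have "{a<..<b} \<subseteq> C"
    using mem_closed_if_AE_lebesgue_open[OF open_greaterThanLessThan \<open>closed C\<close>] by blast
  then have "closure {a<..<b} \<subseteq> C"
    using \<open>closed C\<close> by (rule closure_minimal)
  then have "ereal \<bar>f x\<bar> \<le> ?E"
    using x \<open>a < b\<close> by (auto simp: C_def)
  then show ?thesis
    unfolding Linf_norm_def using \<open>?E \<le> ereal B\<close> by (rule le_real_of_ereal)
qed

text \<open>Turns the norms of derivatives in the CFL condition into Lipschitz constants.\<close>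

lemma deriv_on_Lipschitz:
  fixes f :: "real \<Rightarrow> real"
  assumes "a < b" and f: "Ck_on (Suc k) {a..b} f"
    and xy: "x \<in> {a..b}" "y \<in> {a..b}" "x \<le> y"
  shows "\<bar>f y - f x\<bar> \<le> Linf_norm {a..b} (deriv_on {a..b} f) * (y - x)"
proof -
  obtain z where z: "z \<in> {a..b}" "f y - f x = deriv_on {a..b} f z * (y - x)"
    using deriv_on_mvt[OF Ck_onD(1)[OF f], of x y] xy by auto
  have "\<bar>deriv_on {a..b} f z\<bar> \<le> Linf_norm {a..b} (deriv_on {a..b} f)"
    using Linf_norm_ge[OF \<open>a < b\<close> Ck_on_imp_continuous_on[OF Ck_onD(3)[OF f]]] z(1) by simp
  then show ?thesis
    using z(2) xy(3) by (simp add: abs_mult mult_right_mono)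
qed

section \<open>Kernel weights: sign, monotonicity and total mass\<close>

lemma kernel_weight_nonneg:
  assumes "\<forall>x\<in>{0..real N * h}. 0 \<le> w x" "0 \<le> h" "k < N"
    and w: "continuous_on {0..real N * h} w"
  shows "0 \<le> kernel_weight w h k"
proof -
  have sub: "{real k * h..real (k + 1) * h} \<subseteq> {0..real N * h}"
    using assms(2,3) by (auto intro: order_trans mult_right_mono)
  show ?thesis
    unfolding kernel_weight_def
    by (intro integral_nonneg integrable_continuous_interval continuous_on_subset[OF w sub])
      (use sub assms(1) in blast)
qed

text \<open>Both cells have length \<open>h\<close> and share the end point \<open>?z\<close>;
  \<open>w\<close> is at most \<open>w ?z\<close> on the right cell and at least \<open>w ?z\<close>
  on the left one.\<close>

lemma kernel_weight_antimono:
  assumes anti: "antimono_on {0..real N * h} w" and "0 \<le> h" "Suc k < N"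
    and w: "continuous_on {0..real N * h} w"
  shows "kernel_weight w h (Suc k) \<le> kernel_weight w h k"
proof -
  let ?z = "real (Suc k) * h"
  have le: "real (k + 2) * h \<le> real N * h"
    using assms(2,3) by (intro mult_right_mono) auto
  have ord: "0 \<le> real k * h" "real k * h \<le> ?z" "?z \<le> real (k + 2) * h"
    using assms(2) by (auto intro: mult_right_mono)
  have int: "w integrable_on {real k * h..?z}" "w integrable_on {?z..real (k + 2) * h}"
    by (intro integrable_continuous_interval continuous_on_subset[OF w]; use ord le in auto)+
  have "integral {?z..real (k + 2) * h} w \<le> integral {?z..real (k + 2) * h} (\<lambda>_. w ?z)"
    by (intro integral_le int integrable_const_ivl monotone_onD[OF anti]) (use ord le in auto)
  also have "\<dots> = integral {real k * h..?z} (\<lambda>_. w ?z)"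
    using assms(2) ord by (simp add: algebra_simps)
  also have "\<dots> \<le> integral {real k * h..?z} w"
    by (intro integral_le int integrable_const_ivl monotone_onD[OF anti]) (use ord le in auto)
  finally show ?thesis
    by (simp add: kernel_weight_def algebra_simps)
qed

text \<open>For \<open>n = N\<close> this is the whole kernel mass, which later bounds the
  velocities.\<close>

lemma sum_kernel_weight:
  assumes w: "continuous_on {0..real N * h} w" and "0 \<le> h" "n \<le> N"
  shows "(\<Sum>k<n. kernel_weight w h k) = integral {0..real n * h} w"
  using \<open>n \<le> N\<close>
proof (induction n)
  case (Suc n)
  have le: "real n * h \<le> real (Suc n) * h" "real (Suc n) * h \<le> real N * h" "0 \<le> real n * h"
    using Suc.prems \<open>0 \<le> h\<close> by (auto intro: mult_right_mono simp del: of_nat_Suc)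
  have "w integrable_on {0..real (Suc n) * h}"
    by (intro integrable_continuous_interval continuous_on_subset[OF w]) (use le in auto)
  then have "integral {0..real n * h} w + integral {real n * h..real (Suc n) * h} w
      = integral {0..real (Suc n) * h} w"
    by (intro Henstock_Kurzweil_Integration.integral_combine) (use le in auto)
  then show ?case
    using Suc by (simp add: kernel_weight_def)
qed simp

section \<open>Cell averages and bounds for the nonlocal velocity\<close>

lemma cell_average_mem:
  assumes "f integrable_on UNIV" "range f \<subseteq> {a..b}" "0 < h"
  shows "cell_average f h j \<in> {a..b}"
proof -
  let ?l = "(real_of_int j - 1 / 2) * h" and ?u = "(real_of_int j + 1 / 2) * h"
  have lu: "?l \<le> ?u"
    using \<open>0 < h\<close> by (simp add: algebra_simps)
  have int: "f integrable_on {?l..?u}"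
    using assms(1) integrable_on_subinterval by blast
  have f: "a \<le> f x" "f x \<le> b" for x
    using subsetD[OF assms(2) rangeI[of f x]] by auto
  have "integral {?l..?u} (\<lambda>_. a) \<le> integral {?l..?u} f"
    "integral {?l..?u} f \<le> integral {?l..?u} (\<lambda>_. b)"
    by (intro integral_le int integrable_const_ivl; simp only: f)+
  then have "h * a \<le> integral {?l..?u} f" "integral {?l..?u} f \<le> h * b"
    using lu by (auto simp: algebra_simps)
  then show ?thesis
    using \<open>0 < h\<close> by (simp add: cell_average_def field_simps)
qed

text \<open>Abel summation: after shifting \<open>a\<close> by \<open>c\<close> all values are
  nonnegative, and decreasing weights make every interior term nonpositive.\<close>

lemma sum_antimono_diff_le:
  fixes \<gamma> a :: "nat \<Rightarrow> real"
  assumes "\<And>k. k \<le> n \<Longrightarrow> 0 \<le> \<gamma> k" and "\<And>k. k < n \<Longrightarrow> \<gamma> (Suc k) \<le> \<gamma> k"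
    and a: "\<And>k. c \<le> a k"
  shows "(\<Sum>k<Suc n. \<gamma> k * (a k - a (Suc k))) \<le> \<gamma> 0 * (a 0 - c)"
proof -
  \<comment> \<open>The boundary term is kept for the induction, where it absorbs the next summand;
    nonnegativity of \<open>\<gamma> n\<close> discards it at the end.\<close>
  have "(\<Sum>k<Suc n. \<gamma> k * (a k - a (Suc k))) \<le> \<gamma> 0 * (a 0 - c) - \<gamma> n * (a (Suc n) - c)"
    using assms(2)
  proof (induction n)
    case (Suc n)
    have "\<gamma> (Suc n) * (a (Suc n) - c) \<le> \<gamma> n * (a (Suc n) - c)"
      using Suc.prems[of n] a[of "Suc n"] by (intro mult_right_mono) auto
    then show ?case
      using Suc by (simp add: algebra_simps)
  qed (simp add: algebra_simps)
  moreover have "0 \<le> \<gamma> n * (a (Suc n) - c)"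
    using assms(1)[of n] a[of "Suc n"] by simp
  ultimately show ?thesis by simp
qed

lemma nonlocal_velocity_diff:
  "nonlocal_velocity N \<gamma> v r (j - 1) - nonlocal_velocity N \<gamma> v r j
    = (\<Sum>k<N. \<gamma> k * (v (r (j + int k)) - v (r (j + int (Suc k)))))"
  unfolding nonlocal_velocity_def sum_subtractf[symmetric]
  by (intro sum.cong refl) (simp add: right_diff_distrib ac_simps)

text \<open>The bounds see the state only through \<open>v (r j)\<close> and vanish when it equals
  \<open>d\<close> or \<open>c\<close> respectively. This is what prevents a cell value from
  crossing an end point of \<open>I\<close>.\<close>

lemma nonlocal_velocity_diff_bounds:
  assumes "1 \<le> N" and \<gamma>: "\<And>k. k < N \<Longrightarrow> 0 \<le> \<gamma> k" "\<And>k. Suc k < N \<Longrightarrow> \<gamma> (Suc k) \<le> \<gamma> k"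
    and v: "\<And>i. c \<le> v (r i)" "\<And>i. v (r i) \<le> d"
  shows "\<gamma> 0 * (v (r j) - d) \<le> nonlocal_velocity N \<gamma> v r (j - 1) - nonlocal_velocity N \<gamma> v r j"
    and "nonlocal_velocity N \<gamma> v r (j - 1) - nonlocal_velocity N \<gamma> v r j \<le> \<gamma> 0 * (v (r j) - c)"
proof -
  obtain n where N: "N = Suc n"
    using \<open>1 \<le> N\<close> by (cases N) auto
  show "nonlocal_velocity N \<gamma> v r (j - 1) - nonlocal_velocity N \<gamma> v r j \<le> \<gamma> 0 * (v (r j) - c)"
    using sum_antimono_diff_le[of n \<gamma> c "\<lambda>k. v (r (j + int k))"] \<gamma> v
    by (simp only: nonlocal_velocity_diff N) simp
  \<comment> \<open>The lower bound is the same summation applied to \<open>- v\<close> with lower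
    bound \<open>- d\<close>.\<close>
  have "- (nonlocal_velocity N \<gamma> v r (j - 1) - nonlocal_velocity N \<gamma> v r j)
      = (\<Sum>k<N. \<gamma> k * (- v (r (j + int k)) - - v (r (j + int (Suc k)))))"
    unfolding nonlocal_velocity_diff sum_negf[symmetric]
    by (intro sum.cong) (auto simp: algebra_simps)
  also have "\<dots> \<le> \<gamma> 0 * (- v (r j) - - d)"
    using sum_antimono_diff_le[of n \<gamma> "- d" "\<lambda>k. - v (r (j + int k))"] \<gamma> v
    by (simp only: N) simp
  finally show "\<gamma> 0 * (v (r j) - d) \<le> nonlocal_velocity N \<gamma> v r (j - 1) - nonlocal_velocity N \<gamma> v r j"
    by (simp add: algebra_simps)
qed

lemma nonlocal_velocity_bounds:
  assumes "\<And>k. k < N \<Longrightarrow> 0 \<le> \<gamma> k" "sum \<gamma> {..<N} \<le> 1"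
    and v: "\<And>i. 0 \<le> v (r i)" "\<And>i. v (r i) \<le> d"
  shows "0 \<le> nonlocal_velocity N \<gamma> v r j" "nonlocal_velocity N \<gamma> v r j \<le> d"
proof -
  show "0 \<le> nonlocal_velocity N \<gamma> v r j"
    unfolding nonlocal_velocity_def using assms by (intro sum_nonneg) auto
  have "0 \<le> d"
    using v[of 0] by simp
  have "nonlocal_velocity N \<gamma> v r j \<le> (\<Sum>k<N. \<gamma> k * d)"
    unfolding nonlocal_velocity_def using assms by (intro sum_mono mult_left_mono) auto
  also have "\<dots> \<le> d"
    using mult_right_mono[OF assms(2) \<open>0 \<le> d\<close>] by (simp add: sum_distrib_right)
  finally show "nonlocal_velocity N \<gamma> v r j \<le> d" .
qed

section \<open>One step of the scheme: invariance and entropy inequality\<close>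

text \<open>Monotonicity of \<open>g\<close> allows the upstream value \<open>y\<close> to be
  replaced by the worst end point. What remains splits into a velocity difference and a difference
  of \<open>g\<close>, both controlled by the distance of \<open>x\<close> to that end point; CFL
  bounds the move by this distance.\<close>

lemma flux_step_mem:
  fixes g :: "real \<Rightarrow> real"
  assumes g: "mono_on {a..b} g" "\<And>x. x \<in> {a..b} \<Longrightarrow> 0 \<le> g x \<and> g x \<le> G"
    and lip: "\<And>x y. x \<in> {a..b} \<Longrightarrow> y \<in> {a..b} \<Longrightarrow> x \<le> y \<Longrightarrow> g y - g x \<le> L * (y - x)"
    and xy: "x \<in> {a..b}" "y \<in> {a..b}"
    and V: "0 \<le> V" "0 \<le> V'" "V \<le> Vmax" "0 \<le> L" "0 \<le> K"
    and diff: "V' - V \<le> K * (b - x)" "- K * (x - a) \<le> V' - V"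
    and CFL: "0 \<le> lam" "lam * (K * G + Vmax * L) \<le> 1"
  shows "x - lam * (V * g x - V' * g y) \<in> {a..b}"
proof -
  have ab: "a \<in> {a..b}" "b \<in> {a..b}"
    using xy by auto
  have ya: "V' * g a \<le> V' * g y" and yb: "V' * g y \<le> V' * g b"
    using V xy ab by (auto intro!: mult_left_mono mono_onD[OF g(1)])
  have CFL': "lam * ((K * G + Vmax * L) * d) \<le> d" if "0 \<le> d" for d
    using mult_right_mono[OF CFL(2) that] by (simp add: algebra_simps)
  have V_lip: "V * (g t - g s) \<le> Vmax * (L * (t - s))"
    if "s \<in> {a..b}" "t \<in> {a..b}" "s \<le> t" for s t
    using lip[OF that] V mono_onD[OF g(1) that] by (intro mult_mono) auto
  have "V' * g y - V * g x \<le> (V' - V) * g b + V * (g b - g x)"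
    using yb by (simp add: algebra_simps)
  also have "\<dots> \<le> (K * (b - x)) * G + Vmax * (L * (b - x))"
  proof (intro add_mono V_lip)
    have "(V' - V) * g b \<le> (K * (b - x)) * g b"
      using diff(1) g(2)[OF ab(2)] by (intro mult_right_mono) auto
    also have "\<dots> \<le> (K * (b - x)) * G"
      using g(2)[OF ab(2)] V xy by (intro mult_left_mono) auto
    finally show "(V' - V) * g b \<le> (K * (b - x)) * G" .
  qed (use xy in auto)
  finally have "lam * (V' * g y - V * g x) \<le> lam * ((K * G + Vmax * L) * (b - x))"
    using CFL(1) by (intro mult_left_mono) (auto simp: algebra_simps)
  then have upper: "lam * (V' * g y - V * g x) \<le> b - x"
    using CFL'[of "b - x"] xy by auto
  have "V * g x - V' * g y \<le> - (V' - V) * g a + V * (g x - g a)"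
    using ya by (simp add: algebra_simps)
  also have "\<dots> \<le> (K * (x - a)) * G + Vmax * (L * (x - a))"
  proof (intro add_mono V_lip)
    have "- (V' - V) * g a \<le> (K * (x - a)) * g a"
      using diff(2) g(2)[OF ab(1)] by (intro mult_right_mono) auto
    also have "\<dots> \<le> (K * (x - a)) * G"
      using g(2)[OF ab(1)] V xy by (intro mult_left_mono) auto
    finally show "- (V' - V) * g a \<le> (K * (x - a)) * G" .
  qed (use xy in auto)
  finally have "lam * (V * g x - V' * g y) \<le> lam * ((K * G + Vmax * L) * (x - a))"
    using CFL(1) by (intro mult_left_mono) (auto simp: algebra_simps)
  then have lower: "lam * (V * g x - V' * g y) \<le> x - a"
    using CFL'[of "x - a"] xy by auto
  show ?thesis
    using upper lower by (simp add: algebra_simps)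
qed

text \<open>
  Crandall--Majda argument: the step \<open>H\<close> with frozen velocities is nondecreasing in both arguments,
  so that \<open>H (max x \<kappa>) (max y \<kappa>) - H (min x \<kappa>) (min y \<kappa>)\<close> dominates \<open>\<bar>H x y - H \<kappa> \<kappa>\<bar>\<close>;
  the velocity term enters because \<open>H \<kappa> \<kappa>\<close> differs from \<open>\<kappa>\<close>.
\<close>

lemma flux_step_entropy:
  fixes g :: "real \<Rightarrow> real"
  assumes g: "mono_on S g"
    and lip: "\<And>x y. x \<in> S \<Longrightarrow> y \<in> S \<Longrightarrow> x \<le> y \<Longrightarrow> g y - g x \<le> L * (y - x)"
    and S: "x \<in> S" "y \<in> S" "\<kappa> \<in> S"
    and V: "0 \<le> V" "0 \<le> V'" and lam: "0 \<le> lam" "lam * (V * L) \<le> 1"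
    and z: "z = x - lam * (V * g x - V' * g y)"
  shows "\<bar>z - \<kappa>\<bar> - \<bar>x - \<kappa>\<bar> + lam * (entropy_flux g V \<kappa> x - entropy_flux g V' \<kappa> y)
    + lam * sgn (z - \<kappa>) * g \<kappa> * (V - V') \<le> 0"
proof -
  define H where "H = (\<lambda>x y. x - lam * (V * g x - V' * g y))"
  have H_mono: "H s t \<le> H s' t'" if "s \<in> S" "s' \<in> S" "t \<in> S" "t' \<in> S" "s \<le> s'" "t \<le> t'" for s t s' t'
  proof -
    \<comment> \<open>Monotonicity in the first argument is where the CFL bound enters: the identity
      outgrows the outgoing flux.\<close>
    have "lam * (V * (g s' - g s)) \<le> lam * (V * (L * (s' - s)))"
      using lip that V lam by (intro mult_left_mono) auto
    also have "\<dots> \<le> s' - s"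
      using mult_right_mono[OF lam(2), of "s' - s"] that by (simp add: algebra_simps)
    finally have "lam * (V * (g s' - g s)) \<le> s' - s" .
    moreover have "lam * (V' * g t) \<le> lam * (V' * g t')"
      using V lam that by (intro mult_left_mono mono_onD[OF g]) auto
    ultimately show ?thesis
      by (simp add: H_def algebra_simps)
  qed
  have mem: "max x \<kappa> \<in> S" "min x \<kappa> \<in> S" "max y \<kappa> \<in> S" "min y \<kappa> \<in> S"
    using S by (auto simp: max_def min_def)
  have "H x y \<le> H (max x \<kappa>) (max y \<kappa>)" "H \<kappa> \<kappa> \<le> H (max x \<kappa>) (max y \<kappa>)"
    "H (min x \<kappa>) (min y \<kappa>) \<le> H x y" "H (min x \<kappa>) (min y \<kappa>) \<le> H \<kappa> \<kappa>"
    by (intro H_mono S mem max.cobounded1 max.cobounded2 min.cobounded1 min.cobounded2)+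
  then have "\<bar>H x y - H \<kappa> \<kappa>\<bar> \<le> H (max x \<kappa>) (max y \<kappa>) - H (min x \<kappa>) (min y \<kappa>)"
    by linarith
  also have "\<dots> = \<bar>x - \<kappa>\<bar> - lam * (entropy_flux g V \<kappa> x - entropy_flux g V' \<kappa> y)"
    by (simp add: H_def entropy_flux_def max_def min_def algebra_simps)
  finally have *: "\<bar>H x y - H \<kappa> \<kappa>\<bar> \<le> \<dots>" .
  \<comment> \<open>Since
    \<open>H \<kappa> \<kappa> = \<kappa> - lam * g \<kappa> * (V - V')\<close>, factoring out the
    sign leaves \<open>H x y - H \<kappa> \<kappa>\<close>; for \<open>z = \<kappa>\<close> both
    sides are 0.\<close>
  have "\<bar>z - \<kappa>\<bar> + lam * sgn (z - \<kappa>) * g \<kappa> * (V - V') = sgn (z - \<kappa>) * (H x y - H \<kappa> \<kappa>)"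
    unfolding abs_sgn by (simp add: H_def z algebra_simps)
  also have "\<dots> \<le> \<bar>H x y - H \<kappa> \<kappa>\<bar>"
    by (simp add: sgn_if abs_if)
  finally show ?thesis
    using * by simp
qed

section \<open>The scheme: bounds on the data, invariance of \<open>I\<close>, entropy
  inequality\<close>

theorem theorem3p6:
  fixes \<rho>max W0 \<eta> h \<tau> lam :: real and N :: nat
    and g v \<rho>\<^sub>0 :: "real \<Rightarrow> real" and w :: "real \<Rightarrow> real \<Rightarrow> real"
    and I :: "real set" and \<gamma> :: "nat \<Rightarrow> real" and \<rho> V :: "nat \<Rightarrow> int \<Rightarrow> real"
  assumes "\<rho>max > 0" and I: "I = {0..\<rho>max}"
    and "Ck_on 1 I g" and "\<forall>x\<in>I. g x \<ge> 0" and "\<forall>x\<in>I. deriv_on I g x \<ge> 0"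
    and "Ck_on 2 I v" and "\<forall>x\<in>I. v x \<ge> 0" and "\<forall>x\<in>I. deriv_on I v x \<le> 0"
    and "\<forall>e>0. Ck_on 1 {0..e} (w e)"
    and "\<forall>e>0. \<forall>x\<in>{0..e}. w e x \<ge> 0"
    and "\<forall>e>0. \<forall>x\<in>{0..e}. deriv_on {0..e} (w e) x \<le> 0"
    and "\<forall>e>0. integral {0..e} (w e) = W0"
    and "((\<lambda>e. w e 0) \<longlongrightarrow> 0) at_top"
    (* Needed: for every W0 > 1 the conclusion fails, e.g. for g the identity, v = 1, lambda = 1. *)
    and "W0 \<le> 1"
    and "\<rho>\<^sub>0 \<in> BV I"
    and "\<eta> > 0" and "h > 0" and "N \<ge> 1" and "\<eta> = real N * h"
    and "\<tau> > 0" and lam: "lam = \<tau> / h"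
    and \<gamma>: "\<gamma> = kernel_weight (w \<eta>) h"
    and \<rho>: "\<rho> = godunov N \<gamma> g v lam (cell_average \<rho>\<^sub>0 h)"
    and V: "V = (\<lambda>n. nonlocal_velocity N \<gamma> v (\<rho> n))"
    (* the CFL condition lambda <= 1 / D in the form lambda * D <= 1, void if D = 0 *)
    and CFL: "lam * (\<gamma> 0 * Linf_norm I (deriv_on I v) * Linf_norm I g
                    + Linf_norm I v * Linf_norm I (deriv_on I g)) \<le> 1"
  shows "\<forall>j n. \<forall>\<kappa>\<in>I.
           \<bar>\<rho> (Suc n) j - \<kappa>\<bar> - \<bar>\<rho> n j - \<kappa>\<bar>
           + lam * (entropy_flux g (V n j) \<kappa> (\<rho> n j) - entropy_flux g (V n (j - 1)) \<kappa> (\<rho> n (j - 1)))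
           + lam * sgn (\<rho> (Suc n) j - \<kappa>) * g \<kappa> * (V n j - V n (j - 1)) \<le> 0"
proof -
  define Lg where "Lg = Linf_norm I (deriv_on I g)"
  define Lv where "Lv = Linf_norm I (deriv_on I v)"
  define Gmax where "Gmax = Linf_norm I g"
  define Vmax where "Vmax = Linf_norm I v"
  have g1: "Ck_on (Suc 0) I g" and v1: "Ck_on (Suc 1) I v"
    using assms(3,6) by (simp_all add: numeral_2_eq_2)
  have g_mono: "mono_on I g"
    using mono_on_if_deriv_on_nonneg Ck_onD(1)[OF g1] assms(5) unfolding I by blast
  have v_anti: "antimono_on I v"
    using antimono_on_if_deriv_on_nonpos Ck_onD(1)[OF v1] assms(8) unfolding I by blast
  have g_lip: "g y - g x \<le> Lg * (y - x)" if "x \<in> I" "y \<in> I" "x \<le> y" for x y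
    using deriv_on_Lipschitz[OF \<open>\<rho>max > 0\<close> g1[unfolded I]] that unfolding I Lg_def
    by (meson abs_le_D1)
  have v_lip: "v x - v y \<le> Lv * (y - x)" if "x \<in> I" "y \<in> I" "x \<le> y" for x y
    using deriv_on_Lipschitz[OF \<open>\<rho>max > 0\<close> v1[unfolded I]] that unfolding I Lv_def
    by (metis abs_le_D2 minus_diff_eq)
  have g_bd: "0 \<le> g x \<and> g x \<le> Gmax" and v_bd: "0 \<le> v x \<and> v x \<le> Vmax" if "x \<in> I" for x
    using Linf_norm_ge[OF \<open>\<rho>max > 0\<close> Ck_onD(2)[OF g1[unfolded I]]] assms(4)
      Linf_norm_ge[OF \<open>\<rho>max > 0\<close> Ck_onD(2)[OF v1[unfolded I]]] assms(7) that
    unfolding I Gmax_def Vmax_def by (meson abs_le_D1)+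
  have I0: "0 \<in> I" "\<rho>max \<in> I"
    using \<open>\<rho>max > 0\<close> by (auto simp: I)
  have Lg0: "0 \<le> Lg" and Lv0: "0 \<le> Lv"
    using Linf_norm_ge[OF \<open>\<rho>max > 0\<close> Ck_on_imp_continuous_on[OF Ck_onD(3)[OF g1[unfolded I]]]]
      Linf_norm_ge[OF \<open>\<rho>max > 0\<close> Ck_on_imp_continuous_on[OF Ck_onD(3)[OF v1[unfolded I]]]] I0(1)
    unfolding I Lg_def Lv_def by (meson abs_ge_zero order_trans)+
  have lam0: "0 \<le> lam"
    using \<open>\<tau> > 0\<close> \<open>h > 0\<close> by (simp add: lam)

  have w1: "Ck_on (Suc 0) {0..real N * h} (w \<eta>)"
    using assms(9) \<open>\<eta> > 0\<close> \<open>\<eta> = real N * h\<close> by simp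
  have w_cont: "continuous_on {0..real N * h} (w \<eta>)"
    using Ck_onD(2)[OF w1] .
  have w_nonneg: "\<forall>x\<in>{0..real N * h}. 0 \<le> w \<eta> x"
    using assms(10) \<open>\<eta> > 0\<close> \<open>\<eta> = real N * h\<close> by simp
  have w_anti: "antimono_on {0..real N * h} (w \<eta>)"
    using antimono_on_if_deriv_on_nonpos[OF Ck_onD(1)[OF w1]] assms(11) \<open>\<eta> > 0\<close> \<open>\<eta> = real N * h\<close>
    by simp
  have \<gamma>_nonneg: "0 \<le> \<gamma> k" if "k < N" for k
    using kernel_weight_nonneg[OF w_nonneg _ that w_cont] \<open>h > 0\<close> by (simp add: \<gamma>)
  have \<gamma>_anti: "\<gamma> (Suc k) \<le> \<gamma> k" if "Suc k < N" for k
    using kernel_weight_antimono[OF w_anti _ that w_cont] \<open>h > 0\<close> by (simp add: \<gamma>)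
  \<comment> \<open>As \<open>\<eta> = N * h\<close>, the weights add up to \<open>W0\<close>; here
    \<open>W0 \<le> 1\<close> enters.\<close>
  have \<gamma>_sum: "sum \<gamma> {..<N} \<le> 1"
    using sum_kernel_weight[OF w_cont, of N] assms(12) \<open>h > 0\<close> \<open>\<eta> > 0\<close> \<open>\<eta> = real N * h\<close> \<open>W0 \<le> 1\<close>
    by (simp add: \<gamma>)
  have \<gamma>0: "0 \<le> \<gamma> 0"
    using \<gamma>_nonneg \<open>N \<ge> 1\<close> by simp

  have step: "\<rho> (Suc n) j = \<rho> n j - lam * (V n j * g (\<rho> n j) - V n (j - 1) * g (\<rho> n (j - 1)))" for n j
    by (simp add: \<rho> V Let_def)
  have CFL': "lam * (\<gamma> 0 * Lv * Gmax + Vmax * Lg) \<le> 1"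
    using CFL by (simp add: Lg_def Lv_def Gmax_def Vmax_def)
  \<comment> \<open>Stated conditionally on the state at time \<open>n\<close>, since
    \<open>v\<close> is controlled only on \<open>I\<close>; this allows its use inside the
    induction below.\<close>
  have V_bd: "0 \<le> V n j" "V n j \<le> Vmax" if "\<And>i. \<rho> n i \<in> I" for n j
    using nonlocal_velocity_bounds[of N \<gamma> v "\<rho> n" Vmax j] \<gamma>_nonneg \<gamma>_sum v_bd that
    by (auto simp: V)
  have \<rho>_mem: "\<rho> n j \<in> I" for n j
  proof (induction n arbitrary: j)
    case 0
    have "\<rho>\<^sub>0 integrable_on UNIV" "range \<rho>\<^sub>0 \<subseteq> {0..\<rho>max}"
      using \<open>\<rho>\<^sub>0 \<in> BV I\<close> by (auto simp: BV_def I absolutely_integrable_on_def)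
    then show ?case
      using cell_average_mem \<open>h > 0\<close> by (simp add: \<rho> I)
  next
    case (Suc n)
    \<comment> \<open>As \<open>v\<close> is nonincreasing, its minimum and maximum sit at
      \<open>\<rho>max\<close> and 0, so the Lipschitz bound turns the velocity estimates into
      distances to these end points.\<close>
    have v_range: "v \<rho>max \<le> v (\<rho> n i)" "v (\<rho> n i) \<le> v 0" for i
      using monotone_onD[OF v_anti] Suc.IH[of i] I0 by (auto simp: I)
    note V_diff = nonlocal_velocity_diff_bounds[of N \<gamma> "v \<rho>max" v "\<rho> n" "v 0" j,
        OF \<open>N \<ge> 1\<close> \<gamma>_nonneg \<gamma>_anti v_range]
    have "V n (j - 1) - V n j \<le> \<gamma> 0 * (v (\<rho> n j) - v \<rho>max)"
      using V_diff(2) by (simp add: V)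
    also have "\<dots> \<le> \<gamma> 0 * (Lv * (\<rho>max - \<rho> n j))"
      using v_lip[OF Suc.IH I0(2)] Suc.IH[of j] \<gamma>0 by (intro mult_left_mono) (auto simp: I)
    finally have up: "V n (j - 1) - V n j \<le> \<gamma> 0 * Lv * (\<rho>max - \<rho> n j)"
      by (simp add: mult.assoc)
    have "\<gamma> 0 * (v 0 - v (\<rho> n j)) \<le> \<gamma> 0 * (Lv * (\<rho> n j - 0))"
      using v_lip[OF I0(1) Suc.IH] Suc.IH[of j] \<gamma>0 by (intro mult_left_mono) (auto simp: I)
    then have low: "- (\<gamma> 0 * Lv) * (\<rho> n j - 0) \<le> V n (j - 1) - V n j"
      using V_diff(1) by (simp add: V algebra_simps)
    show ?case
      unfolding step
      using flux_step_mem[where g = g and a = 0 and b = \<rho>max and G = Gmax and L = Lg,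
          folded I, OF g_mono g_bd g_lip Suc.IH Suc.IH V_bd(1)[OF Suc.IH] V_bd(1)[OF Suc.IH]
            V_bd(2)[OF Suc.IH] Lg0 mult_nonneg_nonneg[OF \<gamma>0 Lv0] up low lam0 CFL'] .
  qed
  show ?thesis
  proof (intro allI ballI)
    fix j n \<kappa> assume "\<kappa> \<in> I"
    have "0 \<le> Gmax"
      using g_bd[OF I0(1)] by simp
    \<comment> \<open>The other CFL summand is nonnegative and \<open>V n j \<le> Vmax\<close>, so
      CFL yields the bound required for frozen velocities.\<close>
    then have "V n j * Lg \<le> \<gamma> 0 * Lv * Gmax + Vmax * Lg"
      using V_bd(2)[OF \<rho>_mem] Lg0 Lv0 \<gamma>0 by (simp add: add_increasing mult_right_mono)
    then have "lam * (V n j * Lg) \<le> 1"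
      using mult_left_mono[OF _ lam0] CFL' order_trans by blast
    from flux_step_entropy[where g = g and S = I and L = Lg, OF g_mono g_lip \<rho>_mem[of n j] \<rho>_mem[of n "j - 1"] \<open>\<kappa> \<in> I\<close>
        V_bd(1)[OF \<rho>_mem, of n j] V_bd(1)[OF \<rho>_mem, of n "j - 1"] lam0 this step]
    show "\<bar>\<rho> (Suc n) j - \<kappa>\<bar> - \<bar>\<rho> n j - \<kappa>\<bar>
           + lam * (entropy_flux g (V n j) \<kappa> (\<rho> n j) - entropy_flux g (V n (j - 1)) \<kappa> (\<rho> n (j - 1)))
           + lam * sgn (\<rho> (Suc n) j - \<kappa>) * g \<kappa> * (V n j - V n (j - 1)) \<le> 0"
      .
  qed
qed

end
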